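(* Let $F$ be a finite field, let $n>1$ be an integer, and let $S\subset M_n(F)\setminus\{0\}$ be a symmetric subset (i.e. $S=-S$). Then the Cayley graph $\Gamma(M_n(F),S)$ is a gcd-graph if and only if there exist an integer $r\ge 0$ and integers $1\le k_1<k_2<\cdots<k_r\le n$ such that $$S=\bigsqcup_{i=1}^r V_{k_i}$$ (the union being empty when $r=0$).
   Context: $M_n(F)$ is the ring of $n\times n$ matrices over $F$, with unit group $M_n(F)^\times=GL_n(F)$. For $1\le k\le n$, $V_k$ denotes the set of all matrices in $M_n(F)$ of rank $k$. For a finite ring $R$ and a symmetric subset $S\subset R\setminus\{0\}$, the Cayley graph $\Gamma(R,S)$ has vertex set $R$, and two vertices $x,y\in R$ are adjacent if $x-y\in S$. The graph $\Gamma(R,S)$ is called a gcd-graph if $S$ is stable under the left and right actions of the unit group $R^\times$, i.e. $R^\times S R^\times=S$. *)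

theory Defs
  imports
    "HOL-Algebra.Coset"
    "Jordan_Normal_Form.DL_Rank"
    "Graph_Theory.Pair_Digraph"
begin

definition connection_set :: "('a, 'b) ring_scheme \<Rightarrow> 'a set \<Rightarrow> bool" where
  "connection_set R S \<longleftrightarrow> S \<subseteq> carrier R - {\<zero>\<^bsub>R\<^esub>} \<and> S = (\<lambda>s. \<ominus>\<^bsub>R\<^esub> s) ` S"

text \<open>
  As usual in the graph library, an undirected graph is given by a symmetric arc relation;
  \<open>cayley_graph_is_graph\<close> below confirms that the result is a finite simple graph.
\<close>

definition cayley_graph :: "('a, 'b) ring_scheme \<Rightarrow> 'a set \<Rightarrow> 'a pair_pre_digraph" where
  "cayley_graph R S =
     \<lparr>pverts = carrier R,
      parcs = {(x, y). x \<in> carrier R \<and> y \<in> carrier R \<and> x \<ominus>\<^bsub>R\<^esub> y \<in> S}\<rparr>"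

text \<open>
  Being a gcd-graph is phrased as a property of the graph itself. The connection set is
  determined by the Cayley graph (it is the neighbourhood of \<open>0\<close>), so the existential quantifier
  adds nothing: see \<open>gcd_graph_cayley_graph_iff\<close> below.
\<close>

definition gcd_graph :: "('a, 'b) ring_scheme \<Rightarrow> 'a pair_pre_digraph \<Rightarrow> bool" where
  "gcd_graph R G \<longleftrightarrow>
     (\<exists>S. connection_set R S \<and> G = cayley_graph R S \<and>
          Units R <#>\<^bsub>R\<^esub> S <#>\<^bsub>R\<^esub> Units R = S)"

definition rank_set :: "'a::field itself \<Rightarrow> nat \<Rightarrow> nat \<Rightarrow> 'a mat set" where
  "rank_set _ n k = {A \<in> carrier_mat n n. vec_space.rank n A = k}"

context ring
begin

lemma cayley_graph_is_graph:
  assumes "finite (carrier R)" "connection_set R S"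
  shows "pair_graph (cayley_graph R S)"
proof
  let ?G = "cayley_graph R S"
  show "finite (pverts ?G)" using assms(1) by (simp add: cayley_graph_def)
  show "finite (parcs ?G)"
    by (rule finite_subset[of _ "carrier R \<times> carrier R"]) (use assms(1) in \<open>auto simp: cayley_graph_def\<close>)
  show "fst e \<in> pverts ?G" "snd e \<in> pverts ?G" if "e \<in> parcs ?G" for e
    using that by (auto simp: cayley_graph_def)
  show "fst e \<noteq> snd e" if "e \<in> parcs ?G" for e
    using that assms(2) by (auto simp: cayley_graph_def connection_set_def minus_eq r_neg)
  have "y \<ominus> x \<in> S" if "x \<in> carrier R" "y \<in> carrier R" "x \<ominus> y \<in> S" for x y
  proof -
    have "y \<ominus> x = \<ominus> (x \<ominus> y)" using that by (simp add: minus_eq minus_add a_comm)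
    then show ?thesis using that(3) assms(2) unfolding connection_set_def by blast
  qed
  then show "symmetric (with_proj ?G)"
    by (auto simp: symmetric_def cayley_graph_def intro!: symI)
qed

lemma connection_set_eq_neighbourhood:
  assumes "connection_set R S"
  shows "S = {x. (x, \<zero>) \<in> parcs (cayley_graph R S)}"
  using assms by (auto simp: cayley_graph_def connection_set_def minus_eq)

lemma gcd_graph_cayley_graph_iff:
  assumes "connection_set R S"
  shows "gcd_graph R (cayley_graph R S) \<longleftrightarrow> Units R <#> S <#> Units R = S"
  using assms connection_set_eq_neighbourhood unfolding gcd_graph_def by metis

end

end

(*
  The theorem reduces to the fact that the double cosets
  GL_n A GL_n are exactly the sets of matrices of a fixed rank. Rank is invariant because right
  multiplication by a unit preserves the column space and left multiplication maps it
  isomorphically. Conversely, a matrix that starts with an identity block can be permuted so that a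
  nonzero entry of the remaining block follows it; clearing the row and the column of that entry
  enlarges the identity block, so every matrix is equivalent to diag(1, ..., 1, 0, ..., 0).
*)
theory Submission
  imports Defs
begin

section \<open>Units of the matrix ring and two-sided equivalence\<close>

abbreviation GL_mat :: "'a::field itself \<Rightarrow> nat \<Rightarrow> 'a mat set" where
  "GL_mat ty n \<equiv> Units (ring_mat ty n ())"

text \<open>\<open>B\<close> lies in the double coset of \<open>A\<close> under the unit group. Only
  \<open>A\<close> carries an explicit dimension condition; that of \<open>B\<close> follows because
  the units are square of size \<open>n\<close>.\<close>

definition mat_equivalent :: "nat \<Rightarrow> 'a::field mat \<Rightarrow> 'a mat \<Rightarrow> bool" where
  "mat_equivalent n A B \<longleftrightarrow> A \<in> carrier_mat n n \<and>
     (\<exists>P \<in> GL_mat TYPE('a) n. \<exists>Q \<in> GL_mat TYPE('a) n. B = P * A * Q)"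

lemma GL_matE:
  assumes "P \<in> GL_mat TYPE('a::field) n"
  obtains P' where "P \<in> carrier_mat n n" "P' \<in> GL_mat TYPE('a) n" "P' \<in> carrier_mat n n"
    "P * P' = 1\<^sub>m n" "P' * P = 1\<^sub>m n"
  using assms unfolding Units_def ring_mat_simps by blast

lemma GL_mat_closed: "P \<in> GL_mat TYPE('a::field) n \<Longrightarrow> P \<in> carrier_mat n n"
  by (auto simp: Units_def ring_mat_simps)

lemma one_in_GL_mat: "1\<^sub>m n \<in> GL_mat TYPE('a::field) n"
  by (auto simp: Units_def ring_mat_simps)

lemma mult_in_GL_mat:
  assumes "P \<in> GL_mat TYPE('a::field) n" "Q \<in> GL_mat TYPE('a) n"
  shows "P * Q \<in> GL_mat TYPE('a) n"
proof -
  interpret ring "ring_mat TYPE('a) n ()" by (rule ring_mat)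
  show ?thesis using Units_m_closed[OF assms] by (simp add: ring_mat_simps)
qed

lemma transpose_in_GL_mat:
  assumes "P \<in> GL_mat TYPE('a::field) n"
  shows "P\<^sup>T \<in> GL_mat TYPE('a) n"
proof -
  obtain P' where P': "P \<in> carrier_mat n n" "P' \<in> carrier_mat n n" "P * P' = 1\<^sub>m n" "P' * P = 1\<^sub>m n"
    using assms by (rule GL_matE)
  have "P\<^sup>T * P'\<^sup>T = 1\<^sub>m n" "P'\<^sup>T * P\<^sup>T = 1\<^sub>m n"
    unfolding transpose_mult[OF P'(1,2), symmetric] transpose_mult[OF P'(2,1), symmetric] P'(3,4)
    by simp_all
  then show ?thesis
    using P' by (auto simp: Units_def ring_mat_simps intro!: bexI[of _ "P'\<^sup>T"])
qed

lemma mat_equivalent_mult_left: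
  assumes "A \<in> carrier_mat n n" "P \<in> GL_mat TYPE('a::field) n"
  shows "mat_equivalent n A (P * A)"
proof -
  have "P * A = P * A * 1\<^sub>m n" using assms GL_mat_closed[OF assms(2)] by simp
  then show ?thesis unfolding mat_equivalent_def using assms one_in_GL_mat by blast
qed

lemma mat_equivalent_carrier:
  assumes "mat_equivalent n A B"
  shows "A \<in> carrier_mat n n" "B \<in> carrier_mat n n"
  using assms by (auto simp: mat_equivalent_def dest!: GL_mat_closed)

lemma mat_equivalent_trans:
  assumes "mat_equivalent n A B" "mat_equivalent n B C"
  shows "mat_equivalent n A (C :: 'a::field mat)"
proof -
  obtain P Q P' Q' where *: "P \<in> GL_mat TYPE('a) n" "Q \<in> GL_mat TYPE('a) n"
    "P' \<in> GL_mat TYPE('a) n" "Q' \<in> GL_mat TYPE('a) n" and A: "A \<in> carrier_mat n n"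
    and B: "B = P * A * Q" and C: "C = P' * B * Q'"
    using assms unfolding mat_equivalent_def by blast
  have "C = (P' * P) * A * (Q * Q')"
    using A *[THEN GL_mat_closed] unfolding B C by (simp add: assoc_mult_mat[of _ n n _ n _ n])
  then show ?thesis
    unfolding mat_equivalent_def using mult_in_GL_mat[OF *(3,1)] mult_in_GL_mat[OF *(2,4)] A by blast
qed

lemma mat_equivalent_sym:
  assumes "mat_equivalent n A B"
  shows "mat_equivalent n B (A :: 'a::field mat)"
proof -
  obtain P Q where P: "P \<in> GL_mat TYPE('a) n" and Q: "Q \<in> GL_mat TYPE('a) n"
    and A: "A \<in> carrier_mat n n" and B: "B = P * A * Q"
    using assms unfolding mat_equivalent_def by blast
  obtain P' where P': "P \<in> carrier_mat n n" "P' \<in> GL_mat TYPE('a) n" "P' \<in> carrier_mat n n"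
    "P' * P = 1\<^sub>m n" using P by (rule GL_matE)
  obtain Q' where Q': "Q \<in> carrier_mat n n" "Q' \<in> GL_mat TYPE('a) n" "Q' \<in> carrier_mat n n"
    "Q * Q' = 1\<^sub>m n" using Q by (rule GL_matE)
  have "P' * B * Q' = (P' * P) * A * (Q * Q')"
    using A P'(1,3) Q'(1,3) unfolding B by (simp add: assoc_mult_mat[of _ n n _ n _ n])
  then have "A = P' * B * Q'" using A unfolding P'(4) Q'(4) by simp
  then show ?thesis
    unfolding mat_equivalent_def using P' Q' mat_equivalent_carrier(2)[OF assms] by blast
qed

text \<open>Transposing reverses the product and keeps units units. This turns each row operation
  below into the corresponding column operation.\<close>

lemma mat_equivalent_transpose:
  assumes "mat_equivalent n A B"
  shows "mat_equivalent n A\<^sup>T (B\<^sup>T :: 'a::field mat)"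
proof -
  obtain P Q where P: "P \<in> GL_mat TYPE('a) n" and Q: "Q \<in> GL_mat TYPE('a) n"
    and A: "A \<in> carrier_mat n n" and B: "B = P * A * Q"
    using assms unfolding mat_equivalent_def by blast
  have "B\<^sup>T = Q\<^sup>T * A\<^sup>T * P\<^sup>T"
    using A GL_mat_closed[OF P] GL_mat_closed[OF Q] unfolding B
    by (simp add: transpose_mult[of _ n n _ n] assoc_mult_mat[of _ n n _ n _ n])
  then show ?thesis
    unfolding mat_equivalent_def using A transpose_in_GL_mat[OF P] transpose_in_GL_mat[OF Q] by auto
qed

section \<open>Reduction to the normal form by row and column operations\<close>

lemma mat_equivalent_swaprows:
  assumes "A \<in> carrier_mat n n" "k < n" "l < n"
  shows "mat_equivalent n A (swaprows k l A)"
  unfolding swaprows_mat[OF assms]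
  using assms swaprows_mat_Unit by (intro mat_equivalent_mult_left)

text \<open>One Gauss-Jordan step at the pivot \<open>(p, p)\<close>: row \<open>p\<close> is scaled
  to make the pivot 1, then multiples of it are subtracted from all other rows. Both operations are
  left multiplications by units.\<close>

lemma mat_equivalent_clear_column:
  fixes A :: "'a::field mat"
  assumes A: "A \<in> carrier_mat n n" and p: "p < n" and nz: "A $$ (p, p) \<noteq> 0"
  shows "mat_equivalent n A (mat n n (\<lambda>(i, j). if i = p then A $$ (p, j) / A $$ (p, p)
     else A $$ (i, j) - A $$ (i, p) * A $$ (p, j) / A $$ (p, p)))" (is "mat_equivalent n A ?B")
proof -
  define A1 where "A1 = multrow p (inverse (A $$ (p, p))) A"
  have A1: "A1 \<in> carrier_mat n n" using A by (simp add: A1_def)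
  have eq1: "mat_equivalent n A A1"
    unfolding A1_def multrow_mat[OF A]
    using A p nz by (intro mat_equivalent_mult_left multrow_mat_Unit) auto
  \<comment> \<open>Each pair holds a factor and the row to which that multiple of row
    \<open>p\<close> is added. As the pivot of \<open>A1\<close> is 1, the factors are the negated
    entries of column \<open>p\<close>.\<close>
  let ?ops = "map (\<lambda>i. (- A1 $$ (i, p), i)) (filter (\<lambda>i. i \<noteq> p) [0..<n])"
  have "?B = eliminate_entries (\<lambda>i. A1 $$ (i, p)) A1 p p"
    using A p by (intro eq_matI) (auto simp: A1_def eliminate_entries_gen_def field_simps)
  also have "\<dots> = eliminate_entries_rec A1 p ?ops"
    using A1 p by (subst eliminate_entries_convert) auto
  finally have B: "?B = \<dots>" .
  have "\<exists>P \<in> GL_mat TYPE('a) n. \<forall>B nc. B \<in> carrier_mat n nc \<longrightarrow> eliminate_entries_rec B p ?ops = P * B"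
    by (rule Unit_prod_eliminate_entries[OF p]) auto
  then obtain P where "P \<in> GL_mat TYPE('a) n" "?B = P * A1"
    unfolding B using A1 by blast
  then have "mat_equivalent n A1 ?B" using mat_equivalent_mult_left[OF A1] by simp
  with eq1 show ?thesis by (rule mat_equivalent_trans)
qed

text \<open>Clear column \<open>p\<close>, transpose, clear column \<open>p\<close> again, transpose
  back. After the first pass column \<open>p\<close> is a unit vector, so the second pass only wipes
  out the rest of row \<open>p\<close>; the remaining entries form the Schur complement of the
  pivot.\<close>

lemma mat_equivalent_schur_complement:
  fixes A :: "'a::field mat"
  assumes A: "A \<in> carrier_mat n n" and p: "p < n" and nz: "A $$ (p, p) \<noteq> 0"
  shows "mat_equivalent n A (mat n n (\<lambda>(i, j). if i = p \<or> j = p then of_bool (i = j)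
     else A $$ (i, j) - A $$ (i, p) * A $$ (p, j) / A $$ (p, p)))" (is "mat_equivalent n A ?B")
proof -
  let ?C = "\<lambda>A. mat n n (\<lambda>(i, j). if i = p then A $$ (p, j) / A $$ (p, p)
     else A $$ (i, j) - A $$ (i, p) * A $$ (p, j) / A $$ (p, p))"
  have "mat_equivalent n ((?C A)\<^sup>T) (?C ((?C A)\<^sup>T))"
    using p nz by (intro mat_equivalent_clear_column) auto
  from mat_equivalent_transpose[OF this] have "mat_equivalent n (?C A) ((?C ((?C A)\<^sup>T))\<^sup>T)"
    by simp
  also have "(?C ((?C A)\<^sup>T))\<^sup>T = ?B"
    using p nz by (intro eq_matI) auto
  finally show ?thesis
    using mat_equivalent_trans[OF mat_equivalent_clear_column[OF A p nz]] by blast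
qed

definition rank_normal_form :: "nat \<Rightarrow> nat \<Rightarrow> 'a::field mat" where
  "rank_normal_form n k = mat n n (\<lambda>(i, j). of_bool (i = j \<and> i < k))"

text \<open>The invariant is that the first \<open>k\<close> rows and columns agree with those of
  the identity. If the remaining block is zero, the matrix is already in normal form; otherwise a
  pivot step raises \<open>k\<close>, and \<open>n - k\<close> decreases.\<close>

lemma mat_equivalent_rank_normal_form_aux:
  fixes A :: "'a::field mat"
  assumes "A \<in> carrier_mat n n" "k \<le> n"
    and "\<And>i j. i < n \<Longrightarrow> j < n \<Longrightarrow> i < k \<or> j < k \<Longrightarrow> A $$ (i, j) = of_bool (i = j)"
  shows "\<exists>l\<le>n. mat_equivalent n A (rank_normal_form n l)"
  using assms
proof (induction "n - k" arbitrary: A k rule: less_induct)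
  case less
  note A = less.prems(1) and block = less.prems(3)
  show ?case
  proof (cases "\<exists>i j. k \<le> i \<and> i < n \<and> k \<le> j \<and> j < n \<and> A $$ (i, j) \<noteq> 0")
    case False
    have "A = rank_normal_form n k"
    proof (rule eq_matI)
      fix a b assume "a < dim_row (rank_normal_form n k :: 'a mat)" "b < dim_col (rank_normal_form n k :: 'a mat)"
      then have ab: "a < n" "b < n" by (simp_all add: rank_normal_form_def)
      have "A $$ (a, b) = 0" if "k \<le> a" "k \<le> b" using that ab False by blast
      then show "A $$ (a, b) = rank_normal_form n k $$ (a, b)"
        using ab block[OF ab] by (cases "a < k \<or> b < k") (auto simp: rank_normal_form_def)
    qed (use A in \<open>simp_all add: rank_normal_form_def\<close>)
    moreover have "mat_equivalent n A A"
      using mat_equivalent_mult_left[OF A one_in_GL_mat] A by simp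
    ultimately show ?thesis using less.prems(2) by auto
  next
    case True
    then obtain i j where ij: "k \<le> i" "i < n" "k \<le> j" "j < n" "A $$ (i, j) \<noteq> 0" by blast
    \<comment> \<open>Swapping rows \<open>k\<close>, \<open>i\<close> and columns \<open>k\<close>,
      \<open>j\<close> moves the nonzero entry to \<open>(k, k)\<close>. Since \<open>i\<close> and
      \<open>j\<close> are at least \<open>k\<close>, the identity block is untouched.\<close>
    define B where "B = (swaprows k j (swaprows k i A)\<^sup>T)\<^sup>T"
    have "mat_equivalent n (swaprows k i A) B"
      using mat_equivalent_transpose[OF mat_equivalent_swaprows[of "(swaprows k i A)\<^sup>T" n k j]] A ij
      by (simp add: B_def)
    then have AB: "mat_equivalent n A B"
      using mat_equivalent_trans[OF mat_equivalent_swaprows[of A n k i]] A ij by simp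
    have B: "B \<in> carrier_mat n n" using A by (simp add: B_def)
    have index_B: "B $$ (a, b) = A $$ (if a = k then i else if a = i then k else a,
        if b = k then j else if b = j then k else b)" if "a < n" "b < n" for a b
      using that A ij by (auto simp: B_def)
    let ?C = "mat n n (\<lambda>(a, b). if a = k \<or> b = k then of_bool (a = b)
      else B $$ (a, b) - B $$ (a, k) * B $$ (k, b) / B $$ (k, k))"
    have "mat_equivalent n B ?C"
      using ij B by (intro mat_equivalent_schur_complement) (auto simp: index_B)
    with AB have AC: "mat_equivalent n A ?C" by (rule mat_equivalent_trans)
    have "\<exists>l\<le>n. mat_equivalent n ?C (rank_normal_form n l)"
    proof (rule less.hyps[of "Suc k"])
      fix a b assume "a < n" "b < n" "a < Suc k \<or> b < Suc k"
      \<comment> \<open>In the last two cases the correction term vanishes: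
        \<open>B $$ (a, k)\<close> is 0 for \<open>a < k\<close>, and \<open>B $$ (k, b)\<close> is
        0 for \<open>b < k\<close>.\<close>
      then consider "a = k \<or> b = k" | "a \<noteq> k" "b \<noteq> k" "a < k" | "a \<noteq> k" "b \<noteq> k" "b < k"
        by linarith
      then show "?C $$ (a, b) = of_bool (a = b)"
        using \<open>a < n\<close> \<open>b < n\<close> ij by cases (simp_all add: index_B block)
    qed (use ij in auto)
    then show ?thesis using AC mat_equivalent_trans by blast
  qed
qed

lemma mat_equivalent_rank_normal_form:
  assumes "A \<in> carrier_mat n n"
  obtains k where "k \<le> n" "mat_equivalent n A (rank_normal_form n k)"
  using mat_equivalent_rank_normal_form_aux[OF assms, of 0] by auto

section \<open>Rank under multiplication by units, and the rank of the normal form\<close>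

lemma rank_mult_GL_mat_right:
  assumes A: "A \<in> carrier_mat n n" and Q: "Q \<in> GL_mat TYPE('a::field) n"
  shows "vec_space.rank n (A * Q) = vec_space.rank n A"
proof -
  interpret vec_space "TYPE('a)" n .
  obtain Q' where Q': "Q \<in> carrier_mat n n" "Q' \<in> carrier_mat n n" "Q * Q' = 1\<^sub>m n"
    using Q by (rule GL_matE)
  have AQ: "A * Q \<in> carrier_mat n n" using A Q' by simp
  \<comment> \<open>A preimage \<open>x\<close> for \<open>A * Q\<close> gives the preimage
    \<open>Q *\<^sub>v x\<close> for \<open>A\<close>; conversely \<open>Q'\<close> carries
    preimages back.\<close>
  have "(\<exists>x\<in>carrier_vec n. (A * Q) *\<^sub>v x = y) \<longleftrightarrow> (\<exists>x\<in>carrier_vec n. A *\<^sub>v x = y)" for y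
  proof
    assume "\<exists>x\<in>carrier_vec n. (A * Q) *\<^sub>v x = y"
    then obtain x where "x \<in> carrier_vec n" "(A * Q) *\<^sub>v x = y" by blast
    then show "\<exists>x\<in>carrier_vec n. A *\<^sub>v x = y"
      using A Q' by (intro bexI[of _ "Q *\<^sub>v x"]) auto
  next
    assume "\<exists>x\<in>carrier_vec n. A *\<^sub>v x = y"
    then obtain x where x: "x \<in> carrier_vec n" "A *\<^sub>v x = y" by blast
    have "(A * Q) *\<^sub>v (Q' *\<^sub>v x) = A *\<^sub>v ((Q * Q') *\<^sub>v x)"
      using A Q'(1,2) x(1) by simp
    then show "\<exists>x\<in>carrier_vec n. (A * Q) *\<^sub>v x = y"
      using x Q' by (intro bexI[of _ "Q' *\<^sub>v x"]) auto
  qed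
  then have "col_space (A * Q) = col_space A"
    using A AQ Q' unfolding col_space_eq[OF A] col_space_eq[OF AQ] by simp
  then show ?thesis by (simp add: rank_def col_space_def)
qed

lemma rank_mult_GL_mat_left:
  assumes A: "A \<in> carrier_mat n n" and P: "P \<in> GL_mat TYPE('a::field) n"
  shows "vec_space.rank n (P * A) = vec_space.rank n A"
proof -
  interpret vec_space "TYPE('a)" n .
  obtain P' where P': "P \<in> carrier_mat n n" "P' \<in> carrier_mat n n" "P' * P = 1\<^sub>m n"
    using P by (rule GL_matE)
  have PA: "P * A \<in> carrier_mat n n" using A P' by simp
  let ?f = "\<lambda>v. P *\<^sub>v v"
  have sub: "set (cols B) \<subseteq> carrier_vec n" if "B \<in> carrier_mat n n" for B :: "'a mat"
    using that cols_dim by blast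
  have subspaces: "VectorSpace.subspace class_ring (col_space B) V" if "B \<in> carrier_mat n n" for B
    unfolding col_space_def using span_is_subspace sub[OF that] by simp
  have range: "col_space B = (\<lambda>v. B *\<^sub>v v) ` carrier_vec n" if "B \<in> carrier_mat n n" for B
    unfolding col_space_eq[OF that] using that by auto
  have closed: "col_space A \<subseteq> carrier_vec n" unfolding range[OF A] using A by auto
  have img: "?f ` col_space A = col_space (P * A)"
    unfolding range[OF A] range[OF PA] image_image
    using assoc_mult_mat_vec[OF P'(1) A] by (intro image_cong) simp_all
  \<comment> \<open>Here the column space itself may change, so both column spaces are made vector
    spaces in their own right and their dimensions are compared along \<open>?f\<close>.\<close>
  interpret V: vectorspace class_ring "vs (col_space A)"
    by (rule subspace_is_vs[OF subspaces[OF A]])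
  interpret W: vectorspace class_ring "vs (col_space (P * A))"
    by (rule subspace_is_vs[OF subspaces[OF PA]])
  interpret linear_map class_ring "vs (col_space A)" "vs (col_space (P * A))" ?f
  proof
    show "?f \<in> LinearCombinations.module_hom class_ring (vs (col_space A)) (vs (col_space (P * A)))"
      using img closed P'(1)
      by (auto simp: LinearCombinations.module_hom_def mult_add_distrib_mat_vec[OF P'(1)] subset_iff
          mult_mat_vec[OF P'(1)])
  qed
  have "inj_on ?f (col_space A)"
  proof (rule inj_onI)
    fix x y assume xy: "x \<in> col_space A" "y \<in> col_space A" and eq: "P *\<^sub>v x = P *\<^sub>v y"
    have left_inverse: "P' *\<^sub>v (P *\<^sub>v v) = v" if "v \<in> col_space A" for v
      using assoc_mult_mat_vec[OF P'(2,1), of v] closed that unfolding P'(3) by auto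
    show "x = y" using left_inverse[OF xy(1)] unfolding eq left_inverse[OF xy(2)] by (rule sym)
  qed
  then have "V.dim = W.dim"
  proof (intro dim_eq)
    show "V.fin_dim" using fin_dim_span_cols[OF A] by (simp add: col_space_def)
  next
    assume "inj_on ?f (col_space A)"
    then show "inj_on ?f (carrier (vs (col_space A)))" by simp
  next
    show "?f ` carrier (vs (col_space A)) = carrier (vs (col_space (P * A)))" using img by simp
  qed
  then show ?thesis by (simp add: rank_def col_space_def)
qed

lemma rank_eq_if_mat_equivalent:
  assumes "mat_equivalent n A B"
  shows "vec_space.rank n B = vec_space.rank n (A :: 'a::field mat)"
proof -
  obtain P Q where *: "P \<in> GL_mat TYPE('a) n" "Q \<in> GL_mat TYPE('a) n" "A \<in> carrier_mat n n"
    "B = P * A * Q"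
    using assms unfolding mat_equivalent_def by blast
  then show ?thesis
    using rank_mult_GL_mat_right[of "P * A" n Q] rank_mult_GL_mat_left[of A n P] GL_mat_closed[of P n]
    by simp
qed

lemma rank_rank_normal_form:
  assumes "k \<le> n"
  shows "vec_space.rank n (rank_normal_form n k :: 'a::field mat) = k"
proof -
  interpret vec_space "TYPE('a)" n .
  let ?U = "(unit_vec n :: nat \<Rightarrow> 'a vec) ` {..<k}"
  have inj: "inj_on (unit_vec n :: nat \<Rightarrow> 'a vec) {..<k}"
    using assms by (intro inj_onI) (simp add: unit_vec_eq)
  have col: "col (rank_normal_form n k) j = (if j < k then unit_vec n j else 0\<^sub>v n :: 'a vec)" if "j < n" for j
    using that by (intro eq_vecI) (auto simp: rank_normal_form_def)
  have cols: "set (cols (rank_normal_form n k :: 'a mat)) = col (rank_normal_form n k) ` {..<n}"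
    by (auto simp: cols_def rank_normal_form_def)
  \<comment> \<open>Only an inclusion into \<open>insert\<close> is claimed, since for
    \<open>k = n\<close> no zero column occurs.\<close>
  have U: "?U \<subseteq> set (cols (rank_normal_form n k))" "set (cols (rank_normal_form n k)) \<subseteq> insert (0\<^sub>v n) ?U"
    using assms unfolding cols by (auto simp: col image_iff)
  have "?U \<subseteq> set (unit_vecs n)" using assms by (auto simp: unit_vecs_def)
  then have "lin_indpt ?U"
    using unit_vecs_basis supset_ld_is_ld unfolding basis_def by blast
  \<comment> \<open>Maximality: the only column that could enlarge \<open>?U\<close> is the zero
    vector, and over a nontrivial ring no independent set contains it.\<close>
  moreover have "B = ?U" if "?U \<subseteq> B" "B \<subseteq> set (cols (rank_normal_form n k))" "lin_indpt B" for B
  proof -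
    have "B \<subseteq> carrier_vec n"
      using that(2) cols_dim[of "rank_normal_form n k :: 'a mat"] by (auto simp: rank_normal_form_def)
    moreover have "(UNIV :: 'a set) \<noteq> {0}" using one_neq_zero by blast
    ultimately have "0\<^sub>v n \<notin> B"
      using zero_nin_lin_indpt[of B] that(3) by simp
    then show ?thesis using that U by blast
  qed
  ultimately have "maximal ?U (\<lambda>T. T \<subseteq> set (cols (rank_normal_form n k)) \<and> lin_indpt T)"
    using U unfolding maximal_def by blast
  then have "rank (rank_normal_form n k) = card ?U"
    by (intro rank_card_indpt[of _ n]) (simp add: rank_normal_form_def)
  then show ?thesis using inj by (simp add: card_image)
qed

section \<open>Equivalence classes are the rank classes\<close>

theorem mat_equivalent_iff_rank_eq:
  assumes "A \<in> carrier_mat n n" "B \<in> carrier_mat n n"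
  shows "mat_equivalent n A B \<longleftrightarrow> vec_space.rank n A = vec_space.rank n (B :: 'a::field mat)"
proof
  assume eq: "vec_space.rank n A = vec_space.rank n B"
  obtain k where k: "k \<le> n" "mat_equivalent n A (rank_normal_form n k)"
    using assms(1) by (rule mat_equivalent_rank_normal_form)
  obtain l where l: "l \<le> n" "mat_equivalent n B (rank_normal_form n l)"
    using assms(2) by (rule mat_equivalent_rank_normal_form)
  \<comment> \<open>Each index is the rank of its normal form, hence of \<open>A\<close> and of
    \<open>B\<close> respectively.\<close>
  have "k = l"
    using k l eq rank_eq_if_mat_equivalent rank_rank_normal_form by metis
  then show "mat_equivalent n A B"
    using k l mat_equivalent_trans mat_equivalent_sym by blast
qed (simp add: rank_eq_if_mat_equivalent)

text \<open>The class of the zero matrix is a singleton because \<open>P * 0 * Q = 0\<close>. This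
  keeps rank 0 out of the ranks of a connection set.\<close>

lemma rank_eq_0_iff:
  assumes "A \<in> carrier_mat n n"
  shows "vec_space.rank n (A :: 'a::field mat) = 0 \<longleftrightarrow> A = 0\<^sub>m n n"
proof
  assume "vec_space.rank n A = 0"
  then have "mat_equivalent n (0\<^sub>m n n) A"
    using assms by (simp add: mat_equivalent_iff_rank_eq vec_space.rank_0I)
  then show "A = 0\<^sub>m n n"
    unfolding mat_equivalent_def by (auto dest!: GL_mat_closed)
qed (simp add: vec_space.rank_0I)

section \<open>Stable connection sets as unions of rank classes\<close>

lemma GL_mat_stable_iff:
  assumes "S \<subseteq> carrier_mat n n"
  shows "GL_mat TYPE('a::field) n <#>\<^bsub>ring_mat TYPE('a) n ()\<^esub> S <#>\<^bsub>ring_mat TYPE('a) n ()\<^esub> GL_mat TYPE('a) n = S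
    \<longleftrightarrow> (\<forall>A\<in>S. \<forall>B\<in>carrier_mat n n. vec_space.rank n B = vec_space.rank n A \<longrightarrow> B \<in> S)"
    (is "?GSG = S \<longleftrightarrow> ?R")
proof -
  have "?GSG = {B. \<exists>A\<in>S. mat_equivalent n A B}"
    using assms by (force simp: set_mult_def mat_equivalent_def ring_mat_simps)
  also have "\<dots> = {B \<in> carrier_mat n n. \<exists>A\<in>S. vec_space.rank n B = vec_space.rank n A}"
    using assms mat_equivalent_iff_rank_eq mat_equivalent_carrier(2) by (metis (mono_tags, lifting) subsetD)
  \<comment> \<open>The last set always contains \<open>S\<close>, so equality amounts to the
    reverse inclusion, which is the right-hand side.\<close>
  finally show ?thesis using assms by blast
qed

theorem corollary3p2:
  fixes n :: nat and S :: "'a::{field,finite} mat set"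
  defines "R \<equiv> ring_mat TYPE('a) n ()"
  assumes "n > 1" and "connection_set R S"
  shows "gcd_graph R (cayley_graph R S) \<longleftrightarrow>
    (\<exists>(r::nat) (k :: nat \<Rightarrow> nat).
       (\<forall>i\<in>{1..r}. 1 \<le> k i \<and> k i \<le> n) \<and> strict_mono_on {1..r} k \<and>
       disjoint_family_on (\<lambda>i. rank_set TYPE('a) n (k i)) {1..r} \<and>
       S = (\<Union>i\<in>{1..r}. rank_set TYPE('a) n (k i)))"
    (is "_ \<longleftrightarrow> ?union")
proof -
  let ?rk = "vec_space.rank n :: 'a mat \<Rightarrow> nat"
  interpret ring R unfolding R_def by (rule ring_mat)
  have S: "S \<subseteq> carrier_mat n n" "0\<^sub>m n n \<notin> S"
    using assms(3) by (auto simp: connection_set_def R_def ring_mat_simps)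
  have "gcd_graph R (cayley_graph R S) \<longleftrightarrow>
      (\<forall>A\<in>S. \<forall>B\<in>carrier_mat n n. ?rk B = ?rk A \<longrightarrow> B \<in> S)"
    unfolding gcd_graph_cayley_graph_iff[OF assms(3)] unfolding R_def by (rule GL_mat_stable_iff[OF S(1)])
  also have "\<dots> \<longleftrightarrow> ?union"
  proof
    assume stable: "\<forall>A\<in>S. \<forall>B\<in>carrier_mat n n. ?rk B = ?rk A \<longrightarrow> B \<in> S"
    have ranks: "?rk ` S \<subseteq> {1..n}"
    proof
      fix m assume "m \<in> ?rk ` S"
      then obtain A where A: "A \<in> S" "m = ?rk A" by blast
      with S have "A \<in> carrier_mat n n" "A \<noteq> 0\<^sub>m n n" by auto
      then show "m \<in> {1..n}"
        using A(2) rank_eq_0_iff[of A n] vec_space.rank_le_nc[of A n n] by simp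
    qed
    then have "finite (?rk ` S)" using finite_subset by blast
    \<comment> \<open>\<open>h\<close> lists the finitely many ranks occurring in \<open>S\<close>
      in increasing order, with indices from 0; \<open>k\<close> shifts them to start at 1. For
      empty \<open>S\<close> this gives \<open>r = 0\<close>.\<close>
    then obtain h where h: "bij_betw h {..<card (?rk ` S)} (?rk ` S)"
      "strict_mono_on {..<card (?rk ` S)} h"
      by (rule ex_bij_betw_strict_mono_card)
    define r where "r = card (?rk ` S)"
    define k where "k i = h (i - 1)" for i
    have "(\<lambda>i. i - 1) ` {1..r} = {..<r}"
      by (force simp: image_iff)
    then have img: "k ` {1..r} = ?rk ` S"
      using h(1) unfolding k_def r_def bij_betw_def by (metis image_image)
    have mono: "strict_mono_on {1..r} k"
      unfolding k_def r_def by (intro strict_mono_onI strict_mono_onD[OF h(2)]) auto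
    \<comment> \<open>A matrix has only one rank and \<open>k\<close> is injective, so distinct
      indices give disjoint classes.\<close>
    have disj: "disjoint_family_on (\<lambda>i. rank_set TYPE('a) n (k i)) {1..r}"
      using strict_mono_on_imp_inj_on[OF mono]
      by (auto simp: disjoint_family_on_def rank_set_def inj_on_eq_iff)
    \<comment> \<open>Stability puts the whole rank class of each element of \<open>S\<close> inside
      \<open>S\<close>.\<close>
    have "S = (\<Union>m\<in>?rk ` S. rank_set TYPE('a) n m)"
      using S(1) stable by (auto simp: rank_set_def)
    then have "S = (\<Union>i\<in>{1..r}. rank_set TYPE('a) n (k i))"
      unfolding img[symmetric] by simp
    moreover have "\<forall>i\<in>{1..r}. 1 \<le> k i \<and> k i \<le> n"
      using img ranks by (metis atLeastAtMost_iff image_eqI subsetD)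
    ultimately show ?union using mono disj by blast
  next
    assume ?union
    then show "\<forall>A\<in>S. \<forall>B\<in>carrier_mat n n. ?rk B = ?rk A \<longrightarrow> B \<in> S"
      by (auto simp: rank_set_def)
  qed
  finally show ?thesis .
qed

end
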